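(* Let $w:\mathbb{R}^n\to\mathbb{R}^n$ and consider the perturbed system $z_{k+1}=\bar w(z_k,q_k)=w(z_k)+q_k$, $k\in\mathbb{N}$, with equilibrium $z^e\in\mathbb{R}^n$ when $q_k=0$ for all $k\in\mathbb{N}$ (i.e. $w(z^e)=z^e$). Suppose there exist a locally Lipschitz function $V:\mathbb{R}^n\to\mathbb{R}_{\ge 0}$ and constants $c\in(0,1)$, $R>0$, $c_1,c_2>0$ such that $$c_1\|z-z^e\|^2\le V(z)\le c_2\|z-z^e\|^2\qquad\forall z\in\mathcal{B}_R(z^e),$$ $$V(\bar w(z,0))-V(z)\le -c\,V(z)\qquad\forall z\in\mathcal{B}_R(z^e).$$ Then there exist a class-$\mathcal{K}$ function $\gamma$ and radii $\bar r,\bar q>0$ such that, for every perturbation sequence with $\sup_k\|q_k\|\le\bar q$ and every initial condition $z_0\in\mathcal{B}_{\bar r}(z^e)$, the corresponding solution of $z_{k+1}=w(z_k)+q_k$ satisfies $$\|z_k-z^e\|\le\sqrt{\frac{c_2}{c_1}}\,\|z_0-z^e\|\,(1-c)^{k/2}+\gamma\Bigl(\sup_{0\le j\le k}\|q_j\|\Bigr),\qquad k\ge 0.$$ In particular, $z^e$ is locally exponentially stable when $q_k=0$ for all $k\in\mathbb{N}$, and the system is locally input-to-state stable (ISS) at $z^e$ with respect to perturbations $q_k\in\mathcal{B}_{\bar q}(0)$, $k\in\mathbb{N}$.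
   Context: $\mathbb{N}$ includes $0$; $\|\cdot\|$ is the Euclidean norm; $\mathcal{B}_\delta(z^* )=\{z\in\mathbb{R}^n:\|z-z^*\|\le\delta\}$. A continuous function $\alpha:[0,a)\to[0,\infty)$ ($a>0$ or $a=\infty$) is of class $\mathcal{K}$ if it is strictly increasing and $\alpha(0)=0$. A continuous $\beta:[0,\infty)\times[0,\infty)\to[0,\infty)$ is of class $\mathcal{KL}$ if $\beta(\cdot,t)\in\mathcal{K}$ for each fixed $t\ge0$ and, for each fixed $s\ge0$, $\beta(s,\cdot)$ is decreasing (not necessarily strictly) with $\beta(s,t)\to0$ as $t\to\infty$. Local exponential stability of $z^e$ for $z_{k+1}=w(z_k)$: there exist $M>0$, $\nu\in(0,1)$, $\delta>0$ with $\|z_k-z^e\|\le M\nu^k\|z_0-z^e\|$ for all $k\in\mathbb{N}$ and all $z_0\in\mathcal{B}_\delta(z^e)$. Local ISS with respect to perturbations in $\mathcal{B}_{\bar q}(0)$: there exist $\delta>0$, $\beta\in\mathcal{KL}$, $\gamma\in\mathcal{K}$ such that for all sequences $\{q_k\}\subset\mathcal{B}_{\bar q}(0)$, all $z_0\in\mathcal{B}_\delta(z^e)$ and all $k\in\mathbb{N}$, $\|z_k-z^e\|\le\beta(\|z_0-z^e\|,k)+\gamma(\sup_{0\le j\le k}\|q_j\|)$.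
   Formalization: The formal theorem additionally assumes that w is continuous at the equilibrium z^e; without this the claim is false (w may jump out of B_R(z^e) to a point where V vanishes), and the claimed estimate itself forces this continuity. *)

theory Defs
  imports "HOL-Analysis.Analysis"
begin

text \<open>
  A function of class \<open>K\<close> has domain \<open>[0, a)\<close> with \<open>0 < a \<le> \<infinity>\<close>. Since functions are total here,
  the bound \<open>a\<close> is a parameter and the values of \<open>\<alpha>\<close> outside \<open>[0, a)\<close> are irrelevant.
\<close>

definition class_K :: "ereal \<Rightarrow> (real \<Rightarrow> real) \<Rightarrow> bool" where
  "class_K a \<alpha> \<longleftrightarrow>
     0 < a \<and>
     continuous_on {s. 0 \<le> s \<and> ereal s < a} \<alpha> \<and>
     strict_mono_on {s. 0 \<le> s \<and> ereal s < a} \<alpha> \<and>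
     (\<forall>s. 0 \<le> s \<and> ereal s < a \<longrightarrow> 0 \<le> \<alpha> s) \<and>
     \<alpha> 0 = 0"

definition class_KL :: "(real \<Rightarrow> real \<Rightarrow> real) \<Rightarrow> bool" where
  "class_KL \<beta> \<longleftrightarrow>
     continuous_on ({0..} \<times> {0..}) (\<lambda>(s, t). \<beta> s t) \<and>
     (\<forall>t\<ge>0. class_K \<infinity> (\<lambda>s. \<beta> s t)) \<and>
     (\<forall>s\<ge>0. antimono_on {0..} (\<beta> s) \<and> (\<beta> s \<longlongrightarrow> 0) at_top)"

definition locally_lipschitz :: "('a::metric_space \<Rightarrow> 'b::metric_space) \<Rightarrow> bool" where
  "locally_lipschitz f \<longleftrightarrow> (\<forall>x. \<exists>u>0. \<exists>L. L-lipschitz_on (cball x u) f)"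

definition perturbed :: "('a \<Rightarrow> 'a) \<Rightarrow> 'a \<Rightarrow> 'a \<Rightarrow> 'a::real_normed_vector" where
  "perturbed w z q = w z + q"

definition solution :: "('a \<Rightarrow> 'b \<Rightarrow> 'a) \<Rightarrow> (nat \<Rightarrow> 'b) \<Rightarrow> (nat \<Rightarrow> 'a) \<Rightarrow> bool" where
  "solution f q z \<longleftrightarrow> (\<forall>k. z (Suc k) = f (z k) (q k))"

definition locally_exp_stable :: "('a::real_normed_vector \<Rightarrow> 'a) \<Rightarrow> 'a \<Rightarrow> bool" where
  "locally_exp_stable w ze \<longleftrightarrow>
     (\<exists>M \<nu> \<delta>. 0 < M \<and> 0 < \<nu> \<and> \<nu> < 1 \<and> 0 < \<delta> \<and>
        (\<forall>z. (\<forall>k. z (Suc k) = w (z k)) \<and> z 0 \<in> cball ze \<delta> \<longrightarrow>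
             (\<forall>k. norm (z k - ze) \<le> M * \<nu> ^ k * norm (z 0 - ze))))"

text \<open>
  The condition \<open>ereal qbar < a\<close> says that the gain \<open>\<gamma>\<close> is only evaluated inside its domain \<open>[0, a)\<close>.
\<close>

definition locally_ISS ::
    "('a::real_normed_vector \<Rightarrow> 'b::real_normed_vector \<Rightarrow> 'a) \<Rightarrow> 'a \<Rightarrow> real \<Rightarrow> bool" where
  "locally_ISS f ze qbar \<longleftrightarrow>
     (\<exists>\<delta> \<beta> a \<gamma>. 0 < \<delta> \<and> class_KL \<beta> \<and> class_K a \<gamma> \<and> ereal qbar < a \<and>
        (\<forall>q z. (\<forall>k. q k \<in> cball 0 qbar) \<and> solution f q z \<and> z 0 \<in> cball ze \<delta> \<longrightarrow>
             (\<forall>k. norm (z k - ze) \<le> \<beta> (norm (z 0 - ze)) (real k)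
                                     + \<gamma> (SUP j\<in>{0..k}. norm (q j)))))"

end

theory Submission
  imports Defs
begin

text \<open>
  Near the equilibrium, \<open>V\<close> contracts by the factor \<open>1 - c\<close> along the nominal map, and a perturbation
  \<open>q\<close> changes the value of \<open>V\<close> at the next state by at most \<open>L * norm q\<close>, where \<open>L\<close> is a Lipschitz
  constant of \<open>V\<close> around \<open>ze\<close>. Thus \<open>V (z (Suc k)) \<le> (1 - c) * V (z k) + L * norm (q k)\<close>
  (\<open>perturbed_decrease_near_equilibrium\<close>), and summing the geometric series gives
  \<open>V (z k) \<le> (1 - c) ^ k * V (z 0) + (L / c) * sup norm q\<close> (\<open>affine_recursion_bound\<close>). Dividing by \<open>c1\<close>
  and taking square roots, which are subadditive, yields the claimed estimate
  (\<open>Lyapunov_perturbed_estimate\<close>) with the gain \<open>\<gamma> s = sqrt (L / (c * c1) * s)\<close>.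

  The decrease of \<open>V\<close> is only available where the Lipschitz bound and the hypotheses on \<open>V\<close> apply, so
  solutions have to be confined. Continuity of \<open>w\<close> at \<open>ze\<close> provides a radius \<open>r\<close> such that one step
  from \<open>cball ze r\<close> stays in the region where \<open>V\<close> is under control. A sublevel set then serves as a
  trap: if \<open>V z \<le> c1 * r\<^sup>2\<close> for some \<open>z\<close> in \<open>cball ze R\<close>, the lower quadratic bound puts \<open>z\<close> into \<open>cball ze r\<close>, and
  the contraction leaves the slack \<open>c * c1 * r\<^sup>2\<close> for the perturbation, so the sublevel set is
  invariant under small perturbations with \<open>L * norm q \<le> c * c1 * r\<^sup>2\<close>. Initial states with
  \<open>c2 * (norm (z - ze))\<^sup>2 \<le> c1 * r\<^sup>2\<close> start inside the trap.

  The bound is of the form required for input-to-state stability, because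
  \<open>sqrt (c2 / c1) * s * (1 - c) powr (t / 2)\<close> is a class-\<open>KL\<close> function of \<open>(s, t)\<close>; for \<open>q = 0\<close> the
  gain term vanishes and the bound is exponential stability with rate \<open>sqrt (1 - c)\<close>.
\<close>

section \<open>Comparison functions\<close>

lemma class_K_infinityI:
  assumes "continuous_on {0..} \<alpha>" "strict_mono_on {0..} \<alpha>" "\<alpha> 0 = 0"
  shows "class_K \<infinity> \<alpha>"
proof -
  have dom: "{s. 0 \<le> s \<and> ereal s < \<infinity>} = {0..}"
    by auto
  have "0 \<le> \<alpha> s" if "0 \<le> s" for s
    using strict_mono_onD[OF assms(2), of 0 s] assms(3) that by (cases "s = 0") auto
  then show ?thesis
    unfolding class_K_def dom using assms by auto
qed

lemma class_K_sqrt: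
  assumes "0 < K"
  shows "class_K \<infinity> (\<lambda>s. sqrt (K * s))"
proof (rule class_K_infinityI)
  show "continuous_on {0..} (\<lambda>s. sqrt (K * s))"
    by (intro continuous_intros)
  show "strict_mono_on {0..} (\<lambda>s. sqrt (K * s))"
    using assms by (auto intro!: strict_mono_onI)
qed simp

lemma class_KL_linear_exponential:
  assumes C: "0 < C" and a: "0 < a" "a < 1"
  shows "class_KL (\<lambda>s t. C * s * a powr (t / 2))"
proof -
  have cont: "continuous_on ({0..} \<times> {0..}) (\<lambda>(s::real, t::real). C * s * a powr (t / 2))"
    unfolding case_prod_unfold using a by (auto intro!: continuous_intros)
  have K: "class_K \<infinity> (\<lambda>s. C * s * a powr (t / 2))" for t
  proof (rule class_K_infinityI)
    show "continuous_on {0..} (\<lambda>s. C * s * a powr (t / 2))"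
      by (intro continuous_intros)
    show "strict_mono_on {0..} (\<lambda>s. C * s * a powr (t / 2))"
      using C a by (auto intro!: strict_mono_onI)
  qed simp
  have anti: "antimono_on {0..} (\<lambda>t. C * s * a powr (t / 2))" if "0 \<le> s" for s
    using that C a by (intro monotone_onI mult_left_mono powr_mono') auto
  have lim: "((\<lambda>t. C * s * a powr (t / 2)) \<longlongrightarrow> 0) at_top" for s
  proof -
    have "ln a < 0"
      using a by simp
    then have "filterlim (\<lambda>t. (ln a / 2) * t) at_bot at_top"
      by (intro filterlim_tendsto_neg_mult_at_bot[OF tendsto_const] filterlim_ident) auto
    then have "((\<lambda>t. exp ((ln a / 2) * t)) \<longlongrightarrow> 0) at_top"
      by (rule filterlim_compose[OF exp_at_bot])
    moreover have "a powr (t / 2) = exp ((ln a / 2) * t)" for t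
      using a by (simp add: powr_def mult.commute)
    ultimately have "((\<lambda>t. a powr (t / 2)) \<longlongrightarrow> 0) at_top"
      by simp
    from tendsto_mult[OF tendsto_const this, of "C * s"] show ?thesis
      by simp
  qed
  show ?thesis
    unfolding class_KL_def using cont K anti lim by blast
qed

section \<open>Dissipation of the Lyapunov function under perturbations\<close>

text \<open>
  The constant \<open>d / c\<close> is the fixed point of \<open>v \<mapsto> (1 - c) * v + d\<close>, to which the distance contracts.
\<close>

lemma affine_recursion_bound:
  fixes v :: "nat \<Rightarrow> real"
  assumes c: "0 < c" "c < 1" and d: "0 \<le> d"
    and step: "\<And>i. i < k \<Longrightarrow> v (Suc i) \<le> (1 - c) * v i + d"
  shows "v k \<le> (1 - c) ^ k * v 0 + d / c"
  using step
proof (induction k)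
  case 0
  then show ?case using c d by simp
next
  case (Suc k)
  have "v (Suc k) \<le> (1 - c) * v k + d"
    using Suc.prems by simp
  also have "\<dots> \<le> (1 - c) * ((1 - c) ^ k * v 0 + d / c) + d"
    using Suc c by (intro add_right_mono mult_left_mono) auto
  also have "\<dots> = (1 - c) ^ Suc k * v 0 + d / c"
    using c by (simp add: field_simps)
  finally show ?case .
qed

text \<open>
  Continuity of \<open>w\<close> at the fixed point \<open>ze\<close> keeps \<open>w z\<close>, and hence also \<open>w z + q\<close> for small \<open>q\<close>,
  inside a ball on which \<open>V\<close> is Lipschitz, so the perturbation costs at most \<open>L * norm q\<close>.
\<close>

lemma perturbed_decrease_near_equilibrium:
  fixes w :: "'a::real_normed_vector \<Rightarrow> 'a" and V :: "'a \<Rightarrow> real"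
  assumes equilibrium: "w ze = ze"
    and w_cont: "isCont w ze"
    and V_lipschitz: "locally_lipschitz V"
    and R: "0 < R"
    and V_decrease: "\<forall>z\<in>cball ze R. V (perturbed w z 0) - V z \<le> - c * V z"
  obtains L r p where "0 < L" "0 < r" "r \<le> R" "0 < p"
    "\<And>z q. z \<in> cball ze r \<Longrightarrow> norm q \<le> p \<Longrightarrow>
       perturbed w z q \<in> cball ze R \<and> V (perturbed w z q) \<le> (1 - c) * V z + L * norm q"
proof -
  obtain u L0 where u: "0 < u" and lip: "L0-lipschitz_on (cball ze u) V"
    using V_lipschitz unfolding locally_lipschitz_def by blast
  \<comment> \<open>A positive Lipschitz constant is needed to make the gain strictly increasing.\<close>
  define L where "L = L0 + 1"
  have L: "0 < L"
    using lipschitz_on_nonneg[OF lip] unfolding L_def by simp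
  have lipL: "L-lipschitz_on (cball ze u) V"
    by (rule lipschitz_on_le[OF lip]) (simp add: L_def)
  define m where "m = min R u"
  have m: "0 < m" "m \<le> R" "m \<le> u"
    using R u unfolding m_def by auto
  obtain s where s: "0 < s" "\<And>z. dist z ze < s \<Longrightarrow> dist (w z) ze < m / 2"
    using w_cont m equilibrium unfolding continuous_at by (metis half_gt_zero LIM_def Lim_at dist_self dist_nz)
  define r where "r = min R (s / 2)"
  have "perturbed w z q \<in> cball ze R \<and> V (perturbed w z q) \<le> (1 - c) * V z + L * norm q"
    if z: "z \<in> cball ze r" and q: "norm q \<le> m / 2" for z q
  proof
    have "dist z ze < s"
      using z s unfolding r_def by (simp add: dist_commute)
    then have wz: "norm (w z - ze) < m / 2"
      using s by (simp add: dist_norm)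
    have "norm (w z + q - ze) \<le> norm (w z - ze) + norm q"
      using norm_triangle_ineq[of "w z - ze" q] by (simp add: algebra_simps)
    then have wzq: "norm (w z + q - ze) \<le> m"
      using wz q by simp
    then show "perturbed w z q \<in> cball ze R"
      using m by (simp add: perturbed_def dist_norm norm_minus_commute)
    have "dist (V (w z + q)) (V (w z)) \<le> L * dist (w z + q) (w z)"
      using wz wzq m by (intro lipschitz_onD[OF lipL]) (auto simp: dist_norm norm_minus_commute)
    then have "V (w z + q) \<le> V (w z) + L * norm q"
      by (simp add: dist_norm abs_le_iff)
    moreover have "V (w z) \<le> (1 - c) * V z"
      using bspec[OF V_decrease, of z] z unfolding r_def perturbed_def by (simp add: algebra_simps)
    ultimately show "V (perturbed w z q) \<le> (1 - c) * V z + L * norm q"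
      unfolding perturbed_def by simp
  qed
  then show ?thesis
    using that[of L r "m / 2"] L m s R unfolding r_def by auto
qed

section \<open>The trajectory estimate\<close>

text \<open>
  The sublevel set \<open>V z \<le> c1 * r\<^sup>2\<close> within \<open>cball ze R\<close> is invariant under small perturbations with
  \<open>L * norm q \<le> c * c1 * r\<^sup>2\<close>, so the dissipation inequality holds at every time and can be iterated.
\<close>

lemma Lyapunov_perturbed_estimate:
  fixes w :: "'a::real_normed_vector \<Rightarrow> 'a" and V :: "'a \<Rightarrow> real"
  assumes equilibrium: "w ze = ze"
    and w_cont: "isCont w ze"
    and V_lipschitz: "locally_lipschitz V"
    and c: "0 < c" "c < 1"
    and R: "0 < R"
    and c1: "0 < c1"
    and c2: "0 < c2"
    and V_bounds: "\<forall>z\<in>cball ze R. c1 * (norm (z - ze))\<^sup>2 \<le> V z \<and> V z \<le> c2 * (norm (z - ze))\<^sup>2"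
    and V_decrease: "\<forall>z\<in>cball ze R. V (perturbed w z 0) - V z \<le> - c * V z"
  obtains K rbar qbar where "0 < K" "0 < rbar" "0 < qbar"
    "\<And>q z k. (\<forall>k. norm (q k) \<le> qbar) \<Longrightarrow> z 0 \<in> cball ze rbar \<Longrightarrow> solution (perturbed w) q z \<Longrightarrow>
       norm (z k - ze) \<le> sqrt (c2 / c1) * norm (z 0 - ze) * (1 - c) powr (real k / 2)
                          + sqrt (K * (SUP j\<in>{0..k}. norm (q j)))"
proof -
  obtain L r p where L: "0 < L" and r: "0 < r" "r \<le> R" and p: "0 < p"
    and step: "\<And>z q. z \<in> cball ze r \<Longrightarrow> norm q \<le> p \<Longrightarrow>
       perturbed w z q \<in> cball ze R \<and> V (perturbed w z q) \<le> (1 - c) * V z + L * norm q"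
    using perturbed_decrease_near_equilibrium[OF equilibrium w_cont V_lipschitz R V_decrease]
    by metis
  define K where "K = L / (c * c1)"
  define qbar where "qbar = min p (c * c1 * r\<^sup>2 / L)"
  define rbar where "rbar = min r (sqrt (c1 / c2) * r)"
  have K: "0 < K" and qbar: "0 < qbar" and rbar: "0 < rbar"
    using L c c1 c2 r p unfolding K_def qbar_def rbar_def by auto
  have estimate: "norm (z k - ze) \<le> sqrt (c2 / c1) * norm (z 0 - ze) * (1 - c) powr (real k / 2)
                          + sqrt (K * (SUP j\<in>{0..k}. norm (q j)))"
    if q: "\<forall>k. norm (q k) \<le> qbar" and z0: "z 0 \<in> cball ze rbar"
      and sol: "solution (perturbed w) q z" for q z k
  proof -
    have in_r: "y \<in> cball ze r" if "y \<in> cball ze R" "V y \<le> c1 * r\<^sup>2" for y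
    proof -
      have "c1 * (norm (y - ze))\<^sup>2 \<le> c1 * r\<^sup>2"
        using V_bounds that by force
      then have "norm (y - ze) \<le> r"
        using c1 r by (simp add: power2_le_iff_abs_le)
      then show ?thesis
        by (simp add: dist_norm norm_minus_commute)
    qed
    have trapped: "z i \<in> cball ze R \<and> V (z i) \<le> c1 * r\<^sup>2" for i
    proof (induction i)
      case 0
      have n: "norm (z 0 - ze) \<le> rbar"
        using z0 by (simp add: dist_norm norm_minus_commute)
      have "z 0 \<in> cball ze R"
        using z0 r unfolding rbar_def by simp
      moreover have "V (z 0) \<le> c2 * (norm (z 0 - ze))\<^sup>2"
        using V_bounds calculation by blast
      moreover have "c2 * (norm (z 0 - ze))\<^sup>2 \<le> c2 * (sqrt (c1 / c2) * r)\<^sup>2"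
        using n c2 unfolding rbar_def by (intro mult_left_mono power_mono) auto
      moreover have "c2 * (sqrt (c1 / c2) * r)\<^sup>2 = c1 * r\<^sup>2"
        using c1 c2 by (simp add: power_mult_distrib)
      ultimately show ?case
        by simp
    next
      case (Suc i)
      have qi: "norm (q i) \<le> p" "norm (q i) \<le> c * c1 * r\<^sup>2 / L"
        using q unfolding qbar_def by auto
      have next_step: "z (Suc i) \<in> cball ze R \<and> V (z (Suc i)) \<le> (1 - c) * V (z i) + L * norm (q i)"
        using step[OF in_r qi(1)] Suc sol unfolding solution_def by simp
      have "(1 - c) * V (z i) \<le> (1 - c) * (c1 * r\<^sup>2)"
        using Suc c by (intro mult_left_mono) auto
      moreover have "L * norm (q i) \<le> c * (c1 * r\<^sup>2)"
        using qi(2) L by (simp add: field_simps)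
      moreover have "(1 - c) * (c1 * r\<^sup>2) + c * (c1 * r\<^sup>2) = c1 * r\<^sup>2"
        by (simp add: algebra_simps)
      ultimately show ?case
        using next_step by linarith
    qed
    define Q where "Q = (SUP j\<in>{0..k}. norm (q j))"
    have Q: "norm (q j) \<le> Q" if "j \<le> k" for j
      unfolding Q_def using that by (intro cSUP_upper) auto
    have Q0: "0 \<le> Q"
      using Q[of 0] norm_ge_zero[of "q 0"] by linarith
    have "V (z (Suc i)) \<le> (1 - c) * V (z i) + L * Q" if "i < k" for i
    proof -
      have "norm (q i) \<le> p"
        using q unfolding qbar_def by simp
      then have "V (z (Suc i)) \<le> (1 - c) * V (z i) + L * norm (q i)"
        using step[OF in_r] trapped[of i] sol unfolding solution_def by simp
      also have "\<dots> \<le> (1 - c) * V (z i) + L * Q"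
        using Q that L by simp
      finally show ?thesis .
    qed
    then have "V (z k) \<le> (1 - c) ^ k * V (z 0) + L * Q / c"
      using c L Q0 by (intro affine_recursion_bound) auto
    also have "\<dots> \<le> (1 - c) ^ k * (c2 * (norm (z 0 - ze))\<^sup>2) + L * Q / c"
      using V_bounds trapped[of 0] c by (intro add_right_mono mult_left_mono) auto
    finally have V_le: "V (z k) \<le> (1 - c) ^ k * (c2 * (norm (z 0 - ze))\<^sup>2) + L * Q / c" .
    have "c1 * (norm (z k - ze))\<^sup>2 \<le> V (z k)"
      using V_bounds trapped by blast
    also note V_le
    finally have "(norm (z k - ze))\<^sup>2 \<le> c2 / c1 * (norm (z 0 - ze))\<^sup>2 * (1 - c) ^ k + K * Q"
      using c1 c unfolding K_def by (simp add: field_simps)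
    then have "norm (z k - ze) \<le> sqrt (c2 / c1 * (norm (z 0 - ze))\<^sup>2 * (1 - c) ^ k + K * Q)"
      by (rule real_le_rsqrt)
    also have "\<dots> \<le> sqrt (c2 / c1 * (norm (z 0 - ze))\<^sup>2 * (1 - c) ^ k) + sqrt (K * Q)"
      using c1 c2 c K Q0 by (intro sqrt_add_le_add_sqrt) auto
    also have "sqrt (c2 / c1 * (norm (z 0 - ze))\<^sup>2 * (1 - c) ^ k)
        = sqrt (c2 / c1) * norm (z 0 - ze) * sqrt ((1 - c) ^ k)"
      by (simp only: real_sqrt_mult real_sqrt_abs abs_norm_cancel)
    also have "sqrt ((1 - c) ^ k) = (1 - c) powr (real k / 2)"
      using c by (simp add: powr_half_sqrt[symmetric] powr_realpow[symmetric] powr_powr)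
    finally show ?thesis
      unfolding Q_def .
  qed
  show ?thesis
    using that[OF K rbar qbar] estimate by blast
qed

theorem theorem1:
  fixes w :: "real ^ 'n \<Rightarrow> real ^ 'n"
    and ze :: "real ^ 'n"
    and V :: "real ^ 'n \<Rightarrow> real"
    and c R c1 c2 :: real
  assumes equilibrium: "w ze = ze"
    and w_cont: "isCont w ze"
    and V_lipschitz: "locally_lipschitz V"
    and V_nonneg: "\<forall>z. 0 \<le> V z"
    and c: "0 < c" "c < 1"
    and R: "0 < R"
    and c1: "0 < c1"
    and c2: "0 < c2"
    and V_bounds: "\<forall>z\<in>cball ze R. c1 * (norm (z - ze))\<^sup>2 \<le> V z \<and> V z \<le> c2 * (norm (z - ze))\<^sup>2"
    and V_decrease: "\<forall>z\<in>cball ze R. V (perturbed w z 0) - V z \<le> - c * V z"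
  shows "(\<exists>a \<gamma> rbar qbar.
            class_K a \<gamma> \<and> 0 < rbar \<and> 0 < qbar \<and> ereal qbar < a \<and>
            (\<forall>q z. (\<forall>k. norm (q k) \<le> qbar) \<and> z 0 \<in> cball ze rbar \<and> solution (perturbed w) q z \<longrightarrow>
               (\<forall>k. norm (z k - ze)
                      \<le> sqrt (c2 / c1) * norm (z 0 - ze) * (1 - c) powr (real k / 2)
                        + \<gamma> (SUP j\<in>{0..k}. norm (q j)))) \<and>
            locally_ISS (perturbed w) ze qbar) \<and>
         locally_exp_stable w ze"
proof -
  obtain K rbar qbar where K: "0 < K" and rbar: "0 < rbar" and qbar: "0 < qbar"
    and estimate: "\<And>q z k. (\<forall>k. norm (q k) \<le> qbar) \<Longrightarrow> z 0 \<in> cball ze rbar \<Longrightarrow>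
       solution (perturbed w) q z \<Longrightarrow>
       norm (z k - ze) \<le> sqrt (c2 / c1) * norm (z 0 - ze) * (1 - c) powr (real k / 2)
                          + sqrt (K * (SUP j\<in>{0..k}. norm (q j)))"
    using Lyapunov_perturbed_estimate[OF equilibrium w_cont V_lipschitz c R c1 c2 V_bounds V_decrease]
    by metis
  have gain: "class_K \<infinity> (\<lambda>s. sqrt (K * s))"
    using K by (rule class_K_sqrt)
  have KL: "class_KL (\<lambda>s t. sqrt (c2 / c1) * s * (1 - c) powr (t / 2))"
    using c c1 c2 by (intro class_KL_linear_exponential) auto
  have ISS: "locally_ISS (perturbed w) ze qbar"
    unfolding locally_ISS_def
    by (rule exI[of _ rbar], rule exI, rule exI[of _ \<infinity>], rule exI, intro conjI, rule rbar, rule KL,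
        rule gain) (auto intro!: estimate)
  have exp_stable: "locally_exp_stable w ze"
    unfolding locally_exp_stable_def
  proof (intro exI conjI allI impI)
    show "0 < sqrt (c2 / c1)" "0 < sqrt (1 - c)" "sqrt (1 - c) < 1" "0 < rbar"
      using c c1 c2 rbar by auto
    fix z k assume z: "(\<forall>k. z (Suc k) = w (z k)) \<and> z 0 \<in> cball ze rbar"
    have "norm (z k - ze) \<le> sqrt (c2 / c1) * norm (z 0 - ze) * (1 - c) powr (real k / 2)"
      using estimate[of "\<lambda>_. 0" z k] z qbar by (simp add: solution_def perturbed_def)
    also have "(1 - c) powr (real k / 2) = sqrt (1 - c) ^ k"
      using c by (simp add: powr_half_sqrt[symmetric] powr_realpow[symmetric] powr_powr)
    finally show "norm (z k - ze) \<le> sqrt (c2 / c1) * sqrt (1 - c) ^ k * norm (z 0 - ze)"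
      by (simp add: mult.assoc mult.commute mult.left_commute)
  qed
  show ?thesis
    using gain rbar qbar ISS exp_stable estimate
    by (intro conjI exI[of _ "\<infinity>::ereal"] exI[of _ "\<lambda>s. sqrt (K * s)"] exI[of _ rbar] exI[of _ qbar])
      auto
qed

end
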